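(* Let $G$ be a connected bipartite $(d_1,d_2)$-semiregular graph $G$. Then there is a group homomorphism $K(\operatorname{line} G) \overset{g}{\rightarrow} K(G)$ whose kernel-cokernel exact sequence $$0 \rightarrow \ker(g) \rightarrow K(\operatorname{line} G) \overset{g}{\rightarrow} K(G) \rightarrow \coker(g) \rightarrow 0$$ has $\coker(g)$ all $\lcm(d_1,d_2)$-torsion, and has $\ker(g)$ all $\frac{d_1+d_2}{\gcd(d_1,d_2)} \lcm(d_1,d_2)$-torsion.
   Context: $K(\cdot)$ denotes the critical group of a graph and $\operatorname{line} G$ the line graph of $G$. A bipartite graph with vertex bipartition $V=V_1\sqcup V_2$ is $(d_1,d_2)$-semiregular if all vertices in $V_i$ have degree $d_i$. *)

theory Defs
  imports "HOL-Algebra.Algebra"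
begin

section \<open>Finite simple graphs, given by a vertex set and a set of two-element edges\<close>

definition simple_graph :: "'a set \<Rightarrow> 'a set set \<Rightarrow> bool" where
  "simple_graph V E \<longleftrightarrow> finite V \<and> (\<forall>e\<in>E. e \<subseteq> V \<and> card e = 2)"

definition connected_graph :: "'a set \<Rightarrow> 'a set set \<Rightarrow> bool" where
  "connected_graph V E \<longleftrightarrow>
     V \<noteq> {} \<and> (\<forall>u\<in>V. \<forall>v\<in>V. (u, v) \<in> {(x, y). {x, y} \<in> E}\<^sup>*)"

definition degree :: "'a set set \<Rightarrow> 'a \<Rightarrow> nat" where
  "degree E v = card {e \<in> E. v \<in> e}"

definition bipartition :: "'a set \<Rightarrow> 'a set set \<Rightarrow> 'a set \<Rightarrow> 'a set \<Rightarrow> bool" where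
  "bipartition V E V1 V2 \<longleftrightarrow>
     V = V1 \<union> V2 \<and> V1 \<inter> V2 = {} \<and> (\<forall>e\<in>E. \<exists>u\<in>V1. \<exists>v\<in>V2. e = {u, v})"

definition semiregular_bipartite ::
  "'a set \<Rightarrow> 'a set set \<Rightarrow> 'a set \<Rightarrow> 'a set \<Rightarrow> nat \<Rightarrow> nat \<Rightarrow> bool" where
  "semiregular_bipartite V E V1 V2 d1 d2 \<longleftrightarrow>
     bipartition V E V1 V2 \<and> (\<forall>v\<in>V1. degree E v = d1) \<and> (\<forall>v\<in>V2. degree E v = d2)"

text \<open>The line graph of \<open>(V, E)\<close> is \<open>(E, line_edges E)\<close>.\<close>

definition line_edges :: "'a set set \<Rightarrow> 'a set set set" where
  "line_edges E = {{e, f} | e f. e \<in> E \<and> f \<in> E \<and> e \<noteq> f \<and> e \<inter> f \<noteq> {}}"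


section \<open>The critical group\<close>

text \<open>The Laplacian, as an endomorphism of the free abelian group on the vertices, sends
  a vertex \<open>v\<close> to \<open>deg(v) v\<close> minus the sum of the neighbours of \<open>v\<close>.\<close>

definition laplacian :: "'a set set \<Rightarrow> ('a \<Rightarrow>\<^sub>0 int) \<Rightarrow> ('a \<Rightarrow>\<^sub>0 int)" where
  "laplacian E =
     frag_extend (\<lambda>v. frag_cmul (int (degree E v)) (frag_of v)
                      - (\<Sum>u\<in>{u. {v, u} \<in> E}. frag_of u))"

definition coker :: "('a, 'm) monoid_scheme \<Rightarrow> ('b, 'n) monoid_scheme \<Rightarrow> ('a \<Rightarrow> 'b) \<Rightarrow> 'b set monoid"
  where "coker A B f = B Mod (f ` carrier A)"

definition kernel_group ::
  "('a, 'm) monoid_scheme \<Rightarrow> ('b, 'n) monoid_scheme \<Rightarrow> ('a \<Rightarrow> 'b) \<Rightarrow> ('a, 'm) monoid_scheme"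
  where "kernel_group A B f = A\<lparr>carrier := kernel A B f\<rparr>"

definition torsion_subgroup :: "('a, 'm) monoid_scheme \<Rightarrow> ('a, 'm) monoid_scheme" where
  "torsion_subgroup A =
     A\<lparr>carrier := {x \<in> carrier A. \<exists>n::nat. n > 0 \<and> x [^]\<^bsub>A\<^esub> n = \<one>\<^bsub>A\<^esub>}\<rparr>"

text \<open>The cokernel of the Laplacian is the direct sum of the critical group and a free abelian
  group with one generator for each connected component.\<close>

definition critical_group :: "'a set \<Rightarrow> 'a set set \<Rightarrow> ('a \<Rightarrow>\<^sub>0 int) set monoid" where
  "critical_group V E =
     torsion_subgroup (coker (free_Abelian_group V) (free_Abelian_group V) (laplacian E))"


section \<open>Torsion and exactness\<close>

text \<open>HOL-Algebra groups are written multiplicatively: \<open>x [^] n\<close> is the multiple \<open>n x\<close>.\<close>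

definition all_torsion :: "nat \<Rightarrow> ('a, 'm) monoid_scheme \<Rightarrow> bool" where
  "all_torsion n A \<longleftrightarrow> (\<forall>x\<in>carrier A. x [^]\<^bsub>A\<^esub> n = \<one>\<^bsub>A\<^esub>)"

text \<open>Exactness of \<open>0 \<rightarrow> A \<rightarrow> B \<rightarrow> C \<rightarrow> D \<rightarrow> 0\<close>. The library predicate \<^const>\<open>exact_seq\<close> does not
  apply, since it requires all groups of the sequence to have the same element type.\<close>

definition exact_0ABCD0 ::
  "('a, 'm) monoid_scheme \<Rightarrow> ('a \<Rightarrow> 'b) \<Rightarrow> ('b, 'n) monoid_scheme \<Rightarrow> ('b \<Rightarrow> 'c) \<Rightarrow>
   ('c, 'k) monoid_scheme \<Rightarrow> ('c \<Rightarrow> 'd) \<Rightarrow> ('d, 'l) monoid_scheme \<Rightarrow> bool" where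
  "exact_0ABCD0 A f B g C h D \<longleftrightarrow>
     group_hom A B f \<and> group_hom B C g \<and> group_hom C D h \<and>
     inj_on f (carrier A) \<and>
     f ` carrier A = kernel B C g \<and>
     g ` carrier B = kernel C D h \<and>
     h ` carrier C = carrier D"

end

theory Submission
  imports Defs
begin

text \<open>Put \<open>a\<^sub>i = d\<^sub>i / gcd(d\<^sub>1, d\<^sub>2)\<close>. Sending an edge with ends \<open>v\<^sub>1 \<in> V\<^sub>1\<close> and
  \<open>v\<^sub>2 \<in> V\<^sub>2\<close> to \<open>a\<^sub>1 v\<^sub>1 + a\<^sub>2 v\<^sub>2\<close> defines a map \<open>P\<close> of free abelian groups. Let \<open>L\<close> and
  \<open>L'\<close> be the Laplacians of \<open>G\<close> and its line graph, and \<open>N\<close> the unsigned incidence matrix. Since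
  \<open>L' = (d\<^sub>1 + d\<^sub>2) I - N\<^sup>T N\<close> and the signless Laplacian is \<open>N N\<^sup>T\<close>, rescaling the two sides of
  the bipartition by \<open>a\<^sub>1, a\<^sub>2\<close> gives \<open>P L' = L U\<close>, \<open>M L = L' R\<close> and
  \<open>M P = a\<^sub>1 a\<^sub>2 ((d\<^sub>1 + d\<^sub>2) I - L')\<close> for the weighted incidence maps \<open>U\<close>, \<open>M\<close>, \<open>R\<close>
  (below, \<open>P\<close>, \<open>U\<close>, \<open>M\<close>, \<open>R\<close> are \<open>down wt\<close>, \<open>down cowt\<close>, \<open>up cowt\<close>, \<open>up wt\<close>).
  The first identity yields \<open>g\<close>, the other two show that \<open>a\<^sub>1 a\<^sub>2 (d\<^sub>1 + d\<^sub>2)\<close> kills its kernel.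
  For the cokernel, \<open>lcm(d\<^sub>1, d\<^sub>2) (u - v)\<close> is explicitly in the image of \<open>P\<close> modulo \<open>L\<close> for
  every edge \<open>uv\<close>, and these differences generate the divisors of degree 0. Those are precisely the
  torsion classes of \<open>G\<close>, by the maximum principle for harmonic functions; that the preimages
  are torsion as well follows from the kernel computation.\<close>

section \<open>Kernels, cokernels and torsion\<close>

text \<open>Commutativity distributes powers over products, so the product of the two orders
  annihilates a product of torsion elements.\<close>

lemma subgroup_torsion_subgroup:
  fixes G (structure)
  assumes "comm_group G"
  shows "subgroup (carrier (torsion_subgroup G)) G"
proof -
  interpret comm_group G by fact
  show ?thesis
  proof
    fix x y assume "x \<in> carrier (torsion_subgroup G)" "y \<in> carrier (torsion_subgroup G)"
    then obtain m n :: nat where x: "x \<in> carrier G" "m > 0" "x [^] m = \<one>"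
      and y: "y \<in> carrier G" "n > 0" "y [^] n = \<one>"
      by (auto simp: torsion_subgroup_def)
    have "x [^] (m * n) = (x [^] m) [^] n" "y [^] (m * n) = (y [^] n) [^] m"
      using nat_pow_pow[OF x(1), of m n] nat_pow_pow[OF y(1), of n m] by (simp_all add: mult.commute)
    then have "(x \<otimes> y) [^] (m * n) = \<one>"
      using x y by (simp add: nat_pow_distrib)
    moreover have "m * n > 0"
      using x y by simp
    ultimately have "\<exists>k::nat. k > 0 \<and> (x \<otimes> y) [^] k = \<one>"
      by blast
    then show "x \<otimes> y \<in> carrier (torsion_subgroup G)"
      using x y by (simp add: torsion_subgroup_def)
  next
    show "\<one> \<in> carrier (torsion_subgroup G)"
      by (auto simp: torsion_subgroup_def)
  next
    fix x assume "x \<in> carrier (torsion_subgroup G)"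
    then obtain n :: nat where "x \<in> carrier G" "n > 0" "x [^] n = \<one>"
      by (auto simp: torsion_subgroup_def)
    moreover from this have "(inv x) [^] n = \<one>"
      by (simp add: nat_pow_inv)
    ultimately show "inv x \<in> carrier (torsion_subgroup G)"
      by (auto simp: torsion_subgroup_def)
  qed (simp add: torsion_subgroup_def subset_iff)
qed

lemma comm_group_torsion_subgroup:
  assumes "comm_group G"
  shows "comm_group (torsion_subgroup G)"
proof -
  interpret comm_group G by fact
  have "group (torsion_subgroup G)"
    using subgroup_imp_group[OF subgroup_torsion_subgroup[OF assms]]
    by (simp add: torsion_subgroup_def)
  then show ?thesis
    by (rule group.group_comm_groupI) (auto simp: torsion_subgroup_def m_comm)
qed

lemma pow_torsion_subgroup [simp]: "x [^]\<^bsub>torsion_subgroup G\<^esub> (n::nat) = x [^]\<^bsub>G\<^esub> n"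
  by (simp add: torsion_subgroup_def nat_pow_def)

lemma one_torsion_subgroup [simp]: "\<one>\<^bsub>torsion_subgroup G\<^esub> = \<one>\<^bsub>G\<^esub>"
  by (simp add: torsion_subgroup_def)

lemma hom_torsion_subgroup:
  assumes "group G" "group H" "f \<in> hom G H"
  shows "f \<in> hom (torsion_subgroup G) (torsion_subgroup H)"
proof -
  interpret group_hom G H f
    using assms by (simp add: group_hom_def group_hom_axioms_def)
  have "f x [^]\<^bsub>H\<^esub> n = \<one>\<^bsub>H\<^esub>" if "x \<in> carrier G" "x [^]\<^bsub>G\<^esub> n = \<one>\<^bsub>G\<^esub>" for x and n :: nat
    using hom_nat_pow[of x n] that by simp
  then show ?thesis
    by (auto simp: torsion_subgroup_def hom_def)
qed

lemma coset_eq_self_iff: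
  assumes "subgroup H G" "group G" "x \<in> carrier G"
  shows "H #>\<^bsub>G\<^esub> x = H \<longleftrightarrow> x \<in> H"
  using assms by (metis group.rcos_self group.coset_join2)

text \<open>Formal: since \<open>B\<close> is abelian the image of \<open>g\<close> is normal, the
  cokernel is a group, and the kernel of the projection onto it is that image.\<close>

lemma kernel_cokernel_exact:
  assumes "group A" "comm_group B" "g \<in> hom A B"
  shows "exact_0ABCD0 (kernel_group A B g) (\<lambda>x. x) A g B
    (\<lambda>y. (g ` carrier A) #>\<^bsub>B\<^esub> y) (coker A B g)"
proof -
  interpret B: comm_group B by fact
  interpret g: group_hom A B g
    using assms by (simp add: group_hom_def group_hom_axioms_def B.group_axioms)
  have sub: "subgroup (g ` carrier A) B"
    by (rule g.img_is_subgroup)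
  have nor: "g ` carrier A \<lhd> B"
    using sub by (rule B.subgroup_imp_normal)
  interpret N: normal "g ` carrier A" B by fact
  have "group (kernel_group A B g)"
    unfolding kernel_group_def by (rule g.G.subgroup_imp_group[OF g.subgroup_kernel])
  moreover have "(\<lambda>x. x) \<in> hom (kernel_group A B g) A"
    by (auto simp: hom_def kernel_group_def kernel_def)
  moreover have "group (coker A B g)"
    unfolding coker_def by (rule N.factorgroup_is_group)
  moreover have "(\<lambda>y. (g ` carrier A) #>\<^bsub>B\<^esub> y) \<in> hom B (coker A B g)"
    unfolding coker_def by (rule N.r_coset_hom_Mod)
  moreover have "g ` carrier A = kernel B (coker A B g) (\<lambda>y. (g ` carrier A) #>\<^bsub>B\<^esub> y)"
  proof -
    have "kernel B (coker A B g) (\<lambda>y. (g ` carrier A) #>\<^bsub>B\<^esub> y)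
      = {y \<in> carrier B. y \<in> g ` carrier A}"
      unfolding kernel_def coker_def one_FactGroup
      using coset_eq_self_iff[OF sub B.group_axioms] by blast
    then show ?thesis
      using subgroup.subset[OF sub] by blast
  qed
  ultimately show ?thesis
    using assms(1,3)
    unfolding exact_0ABCD0_def group_hom_def group_hom_axioms_def
    by (auto simp: kernel_group_def coker_def carrier_FactGroup B.group_axioms)
qed

text \<open>Powers of a coset are computed on a representative, and a coset is trivial exactly when
  its representative lies in the image. Torsion questions about cokernels thus become membership
  questions.\<close>

lemma coker_pow_eq_one_iff:
  assumes "group A" "comm_group B" "g \<in> hom A B" "y \<in> carrier B"
  shows "(g ` carrier A #>\<^bsub>B\<^esub> y) [^]\<^bsub>coker A B g\<^esub> (n::nat) = \<one>\<^bsub>coker A B g\<^esub>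
    \<longleftrightarrow> y [^]\<^bsub>B\<^esub> n \<in> g ` carrier A"
proof -
  interpret B: comm_group B by fact
  interpret g: group_hom A B g
    using assms by (simp add: group_hom_def group_hom_axioms_def B.group_axioms)
  interpret N: normal "g ` carrier A" B
    using g.img_is_subgroup by (rule B.subgroup_imp_normal)
  show ?thesis
    using assms(4) coset_eq_self_iff[OF g.img_is_subgroup B.group_axioms]
    by (simp add: coker_def N.FactGroup_pow)
qed

lemma comm_group_coker:
  assumes "group A" "comm_group B" "g \<in> hom A B"
  shows "comm_group (coker A B g)"
proof -
  interpret B: comm_group B by fact
  interpret g: group_hom A B g
    using assms by (simp add: group_hom_def group_hom_axioms_def B.group_axioms)
  show ?thesis
    unfolding coker_def using g.img_is_subgroup by (rule B.abelian_FactGroup)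
qed

lemma Collect_image_conj: "{Y \<in> f ` A. P Y} = f ` {x \<in> A. P (f x)}"
  by blast

lemma carrier_coker: "carrier (coker A B g) = (\<lambda>y. g ` carrier A #>\<^bsub>B\<^esub> y) ` carrier B"
  by (simp add: coker_def carrier_FactGroup)

lemma all_torsion_coker_iff:
  assumes "group A" "comm_group B" "g \<in> hom A B"
  shows "all_torsion n (coker A B g) \<longleftrightarrow> (\<forall>y\<in>carrier B. y [^]\<^bsub>B\<^esub> n \<in> g ` carrier A)"
  using coker_pow_eq_one_iff[OF assms] by (auto simp: all_torsion_def carrier_coker)

lemma all_torsion_kernel_group_iff:
  "all_torsion n (kernel_group A B g) \<longleftrightarrow>
    (\<forall>x\<in>carrier A. g x = \<one>\<^bsub>B\<^esub> \<longrightarrow> x [^]\<^bsub>A\<^esub> n = \<one>\<^bsub>A\<^esub>)"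
  by (auto simp: all_torsion_def kernel_group_def kernel_def nat_pow_def)

text \<open>\<open>h\<close> followed by the second projection kills the image of \<open>f\<close>,
  hence factors through the first cokernel. The formula on cosets is kept because all later
  computations with the induced map rest on it.\<close>

lemma coker_induced_hom:
  assumes "group A" "comm_group B" "f \<in> hom A B"
    and "group A'" "comm_group B'" "f' \<in> hom A' B'"
    and "h \<in> hom B B'" "h ` f ` carrier A \<subseteq> f' ` carrier A'"
  obtains g where "g \<in> hom (coker A B f) (coker A' B' f')"
    "\<And>x. x \<in> carrier B \<Longrightarrow> g (f ` carrier A #>\<^bsub>B\<^esub> x) = f' ` carrier A' #>\<^bsub>B'\<^esub> h x"
proof -
  interpret B: comm_group B by fact
  interpret B': comm_group B' by fact
  interpret f: group_hom A B f
    using assms by (simp add: group_hom_def group_hom_axioms_def B.group_axioms)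
  interpret f': group_hom A' B' f'
    using assms by (simp add: group_hom_def group_hom_axioms_def B'.group_axioms)
  interpret N: normal "f ` carrier A" B
    using f.img_is_subgroup by (rule B.subgroup_imp_normal)
  interpret N': normal "f' ` carrier A'" B'
    using f'.img_is_subgroup by (rule B'.subgroup_imp_normal)
  have q: "(\<lambda>y. f' ` carrier A' #>\<^bsub>B'\<^esub> y) \<in> hom B' (coker A' B' f')"
    unfolding coker_def by (rule N'.r_coset_hom_Mod)
  have "(\<lambda>x. f' ` carrier A' #>\<^bsub>B'\<^esub> h x) \<in> hom B (coker A' B' f')"
    using hom_compose[OF assms(7) q] by (simp add: o_def)
  moreover have "group (coker A' B' f')"
    unfolding coker_def by (rule N'.factorgroup_is_group)
  ultimately interpret F: group_hom B "coker A' B' f'" "\<lambda>x. f' ` carrier A' #>\<^bsub>B'\<^esub> h x"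
    by (simp add: group_hom_def group_hom_axioms_def B.group_axioms)
  have "f ` carrier A \<subseteq> kernel B (coker A' B' f') (\<lambda>x. f' ` carrier A' #>\<^bsub>B'\<^esub> h x)"
  proof
    fix y assume y: "y \<in> f ` carrier A"
    then have "y \<in> carrier B" "h y \<in> f' ` carrier A'" "h y \<in> carrier B'"
      using assms(8) hom_in_carrier[OF assms(7)] by auto
    then show "y \<in> kernel B (coker A' B' f') (\<lambda>x. f' ` carrier A' #>\<^bsub>B'\<^esub> h x)"
      using coset_eq_self_iff[OF f'.img_is_subgroup B'.group_axioms]
      unfolding kernel_def coker_def one_FactGroup by blast
  qed
  from F.FactGroup_universal_kernel[OF N.normal_axioms this]
  obtain g where "g \<in> hom (B Mod f ` carrier A) (coker A' B' f')"
    "\<And>x. x \<in> carrier B \<Longrightarrow> g (f ` carrier A #>\<^bsub>B\<^esub> x) = f' ` carrier A' #>\<^bsub>B'\<^esub> h x"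
    by blast
  then show thesis
    by (intro that) (simp_all add: coker_def)
qed

section \<open>Integral relations\<close>

text \<open>Gaussian elimination without division: more integer vectors than coordinates are
  linearly dependent over the integers.\<close>

lemma integral_relation:
  fixes f :: "'i \<Rightarrow> 's \<Rightarrow> int"
  assumes "finite S" "finite I" "card S < card I"
  shows "\<exists>c. (\<exists>i\<in>I. c i \<noteq> 0) \<and> (\<forall>s\<in>S. (\<Sum>i\<in>I. c i * f i s) = 0)"
  using assms
proof (induction S arbitrary: I f rule: finite_induct)
  case empty
  then show ?case
    by (intro exI[of _ "\<lambda>_. 1"]) (auto simp: card_gt_0_iff)
next
  case (insert s S)
  show ?case
  proof (cases "\<forall>i\<in>I. f i s = 0")
    case True
    moreover obtain c where "\<exists>i\<in>I. c i \<noteq> 0" "\<forall>t\<in>S. (\<Sum>i\<in>I. c i * f i t) = 0"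
      using insert.IH[of I f] insert.prems insert.hyps by auto
    ultimately show ?thesis
      by (intro exI[of _ c]) auto
  next
    case False
    then obtain j where j: "j \<in> I" "f j s \<noteq> 0" by blast
    define I' where "I' = I - {j}"
    \<comment> \<open>The pivot \<open>j\<close> is dropped, and cross multiplication with it clears
      coordinate \<open>s\<close> of every other vector; the induction hypothesis is applied to the
      cleared vectors.\<close>
    have "card S < card I'" "finite I'"
      using insert.prems insert.hyps j by (auto simp: I'_def card_insert_if)
    then obtain c where c: "\<exists>i\<in>I'. c i \<noteq> 0"
      "\<forall>t\<in>S. (\<Sum>i\<in>I'. c i * (f j s * f i t - f i s * f j t)) = 0"
      using insert.IH[of I' "\<lambda>i t. f j s * f i t - f i s * f j t"] by auto
    \<comment> \<open>The coefficient of the pivot is chosen so that the combination of the original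
      vectors equals that of the cleared ones. At \<open>s\<close> it vanishes because the cleared
      vectors do.\<close>
    define c' where "c' i = (if i = j then - (\<Sum>i\<in>I'. c i * f i s) else c i * f j s)" for i
    have sum: "(\<Sum>i\<in>I. c' i * f i t) = (\<Sum>i\<in>I'. c i * (f j s * f i t - f i s * f j t))" for t
    proof -
      have "(\<Sum>i\<in>I. c' i * f i t) = c' j * f j t + (\<Sum>i\<in>I'. c' i * f i t)"
        unfolding I'_def using j insert.prems by (simp add: sum.remove)
      also have "(\<Sum>i\<in>I'. c' i * f i t) = (\<Sum>i\<in>I'. c i * f j s * f i t)"
        by (rule sum.cong) (auto simp: c'_def I'_def)
      finally show ?thesis
        by (simp add: c'_def algebra_simps sum_subtractf sum_distrib_left)
    qed
    have "\<exists>i\<in>I. c' i \<noteq> 0"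
      using c(1) j(2) by (auto simp: c'_def I'_def)
    moreover have "(\<Sum>i\<in>I. c' i * f i t) = 0" if "t \<in> insert s S" for t
      using c(2) that unfolding sum by auto
    ultimately show ?thesis by blast
  qed
qed

section \<open>The Laplacian\<close>

text \<open>Two additive maps that agree on generators agree. Additivity is stated by differences to
  fit the induction rule of free abelian groups.\<close>

lemma frag_linear_eq:
  fixes f g :: "('a \<Rightarrow>\<^sub>0 int) \<Rightarrow> 'b::ab_group_add"
  assumes "Poly_Mapping.keys x \<subseteq> S"
    and "\<And>a. a \<in> S \<Longrightarrow> f (frag_of a) = g (frag_of a)"
    and "\<And>x y. f (x - y) = f x - f y" "\<And>x y. g (x - y) = g x - g y"
  shows "f x = g x"
  using assms(1)
proof (rule free_Abelian_group_induct)
  show "f 0 = g 0" using assms(3)[of 0 0] assms(4)[of 0 0] by simp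
qed (simp_all add: assms)

lemma frag_cmul_diff_right: "frag_cmul k (x - y) = frag_cmul k x - frag_cmul k y"
  by (rule poly_mapping_eqI) (simp add: lookup_minus right_diff_distrib)

lemma keys_sum_subset:
  fixes f :: "'i \<Rightarrow> 'a \<Rightarrow>\<^sub>0 int"
  shows "(\<And>i. i \<in> I \<Longrightarrow> Poly_Mapping.keys (f i) \<subseteq> S) \<Longrightarrow> Poly_Mapping.keys (sum f I) \<subseteq> S"
  using sum_closed_free_Abelian_group[of I f S] by simp

lemma hom_free_Abelian_groupI:
  assumes "\<And>x y. f (x + y) = f x + f y"
    and "\<And>x. Poly_Mapping.keys x \<subseteq> S \<Longrightarrow> Poly_Mapping.keys (f x) \<subseteq> T"
  shows "f \<in> hom (free_Abelian_group S) (free_Abelian_group T)"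
  using assms by (auto simp: hom_def)

lemma laplacian_diff: "laplacian E (x - y) = laplacian E x - laplacian E y"
  by (simp add: laplacian_def frag_extend_diff)

lemma laplacian_add: "laplacian E (x + y) = laplacian E x + laplacian E y"
  by (simp add: laplacian_def frag_extend_add)

lemma laplacian_cmul: "laplacian E (frag_cmul k x) = frag_cmul k (laplacian E x)"
  by (simp add: laplacian_def frag_extend_cmul)

lemma laplacian_0 [simp]: "laplacian E 0 = 0"
  by (simp add: laplacian_def)

lemma laplacian_sum: "finite I \<Longrightarrow> laplacian E (sum f I) = (\<Sum>i\<in>I. laplacian E (f i))"
  by (simp add: laplacian_def frag_extend_sum o_def)

lemma laplacian_frag_of:
  "laplacian E (frag_of v) = frag_cmul (int (degree E v)) (frag_of v) - (\<Sum>u\<in>{u. {v, u} \<in> E}. frag_of u)"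
  by (simp add: laplacian_def)

section \<open>Finite graphs: neighbours and the coefficients of the Laplacian\<close>

locale finite_graph =
  fixes V :: "'a set" and E :: "'a set set"
  assumes graph: "simple_graph V E"
begin

lemma finite_V: "finite V"
  using graph by (simp add: simple_graph_def)

lemma finite_E: "finite E"
  using graph finite_V by (auto simp: simple_graph_def intro: finite_subset[of E "Pow V"])

lemma edge_subset: "e \<in> E \<Longrightarrow> e \<subseteq> V"
  using graph by (simp add: simple_graph_def)

lemma edge_ends: "{u, v} \<in> E \<Longrightarrow> u \<in> V \<and> v \<in> V \<and> u \<noteq> v"
  using graph by (auto simp: simple_graph_def)

lemma finite_neighbours [simp]: "finite {u. {v, u} \<in> E}"
  using finite_V edge_ends by (auto intro: finite_subset[of _ V])

text \<open>An edge at \<open>v\<close> is determined by its other end. This turns sums and counts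
  over incident edges into sums and counts over neighbours.\<close>

lemma bij_betw_neighbours: "bij_betw (\<lambda>u. {v, u}) {u. {v, u} \<in> E} {e \<in> E. v \<in> e}"
proof -
  have ex: "\<exists>u. e = {v, u}" if "e \<in> E" "v \<in> e" for e
  proof -
    have "card e = 2"
      using graph that(1) by (simp add: simple_graph_def)
    then obtain a b where "e = {a, b}"
      by (auto simp: card_2_iff)
    then show ?thesis
      using that(2) by (cases "v = a") auto
  qed
  have "(\<lambda>u. {v, u}) ` {u. {v, u} \<in> E} = {e \<in> E. v \<in> e}"
  proof (intro equalityI subsetI)
    fix e assume "e \<in> {e \<in> E. v \<in> e}"
    with ex[of e] show "e \<in> (\<lambda>u. {v, u}) ` {u. {v, u} \<in> E}" by auto
  qed auto
  moreover have "inj_on (\<lambda>u. {v, u}) {u. {v, u} \<in> E}"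
    by (rule inj_onI) (simp add: doubleton_eq_iff, blast)
  ultimately show ?thesis
    by (simp add: bij_betw_def)
qed

lemma sum_incident: "(\<Sum>e\<in>{e \<in> E. v \<in> e}. f e) = (\<Sum>u\<in>{u. {v, u} \<in> E}. f {v, u})"
  by (rule sum.reindex_bij_betw[OF bij_betw_neighbours, symmetric])

lemma card_neighbours: "card {u. {v, u} \<in> E} = degree E v"
  unfolding degree_def by (rule bij_betw_same_card[OF bij_betw_neighbours])

lemma keys_laplacian:
  assumes "Poly_Mapping.keys x \<subseteq> V"
  shows "Poly_Mapping.keys (laplacian E x) \<subseteq> V"
proof -
  have "Poly_Mapping.keys (laplacian E (frag_of v)) \<subseteq> V" if "v \<in> V" for v
    unfolding laplacian_frag_of using that edge_ends
    by (intro order_trans[OF keys_diff] Un_least order_trans[OF keys_cmul] keys_sum_subset)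
      (auto simp: keys_frag_of)
  then have "(\<Union>v\<in>Poly_Mapping.keys x. Poly_Mapping.keys (laplacian E (frag_of v))) \<subseteq> V"
    using assms by blast
  then show ?thesis
    unfolding laplacian_def frag_extend_of by (rule order_trans[OF keys_frag_extend])
qed

lemma laplacian_hom: "laplacian E \<in> hom (free_Abelian_group V) (free_Abelian_group V)"
  by (rule hom_free_Abelian_groupI) (simp_all add: laplacian_add keys_laplacian)

text \<open>Checked on generators, where the constant terms add up to the degree. The form as a sum
  of differences is the one the maximum principle needs.\<close>

lemma lookup_laplacian:
  assumes "Poly_Mapping.keys x \<subseteq> V"
  shows "poly_mapping.lookup (laplacian E x) v = (\<Sum>u\<in>{u. {v, u} \<in> E}. poly_mapping.lookup x v - poly_mapping.lookup x u)"
  using assms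
proof (rule frag_linear_eq)
  fix a
  have "(\<Sum>u\<in>{u. {v, u} \<in> E}. if u = a then 1 else 0) = (if {v, a} \<in> E then 1 else (0::int))"
    by (simp add: sum.delta)
  moreover have "(\<Sum>u\<in>{u. {a, u} \<in> E}. if v = u then 1 else 0) = (if {a, v} \<in> E then 1 else (0::int))"
    by (simp add: sum.delta')
  ultimately show "poly_mapping.lookup (laplacian E (frag_of a)) v
      = (\<Sum>u\<in>{u. {v, u} \<in> E}. poly_mapping.lookup (frag_of a) v - poly_mapping.lookup (frag_of a) u)"
    by (simp add: laplacian_frag_of lookup_minus lookup_sum sum_subtractf card_neighbours[symmetric] insert_commute)
qed (simp_all add: laplacian_diff lookup_minus sum_subtractf right_diff_distrib)

section \<open>The degree of a divisor, as opposed to the degree of a vertex\<close>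

definition deg :: "('a \<Rightarrow>\<^sub>0 int) \<Rightarrow> int" where
  "deg x = (\<Sum>v\<in>V. poly_mapping.lookup x v)"

lemma deg_diff: "deg (x - y) = deg x - deg y"
  by (simp add: deg_def lookup_minus sum_subtractf)

lemma deg_add: "deg (x + y) = deg x + deg y"
  by (simp add: deg_def lookup_add sum.distrib)

lemma deg_cmul: "deg (frag_cmul k x) = k * deg x"
  by (simp add: deg_def sum_distrib_left)

lemma deg_frag_of: "v \<in> V \<Longrightarrow> deg (frag_of v) = 1"
  using finite_V by (simp add: deg_def sum.delta)

lemma deg_sum: "deg (sum f I) = (\<Sum>i\<in>I. deg (f i))"
  unfolding deg_def lookup_sum by (rule sum.swap)

lemma deg_laplacian:
  assumes "Poly_Mapping.keys x \<subseteq> V"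
  shows "deg (laplacian E x) = 0"
  using assms
proof (rule frag_linear_eq[where g = "\<lambda>_. 0"])
  fix v assume v: "v \<in> V"
  have "(\<Sum>u\<in>{u. {v, u} \<in> E}. deg (frag_of u)) = (\<Sum>u\<in>{u. {v, u} \<in> E}. 1)"
    by (rule sum.cong) (auto simp: deg_frag_of dest: edge_ends)
  then show "deg (laplacian E (frag_of v)) = 0"
    using v by (simp add: laplacian_frag_of deg_diff deg_cmul deg_sum deg_frag_of card_neighbours)
qed (simp_all add: deg_diff laplacian_diff)

section \<open>Principal divisors and divisor classes\<close>

abbreviation principal :: "('a \<Rightarrow>\<^sub>0 int) set" where
  "principal \<equiv> laplacian E ` carrier (free_Abelian_group V)"

abbreviation divisor_class :: "('a \<Rightarrow>\<^sub>0 int) \<Rightarrow> ('a \<Rightarrow>\<^sub>0 int) set" where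
  "divisor_class x \<equiv> principal #>\<^bsub>free_Abelian_group V\<^esub> x"

lemma subgroup_principal: "subgroup principal (free_Abelian_group V)"
  using laplacian_hom
  by (intro group_hom.img_is_subgroup) (simp add: group_hom_def group_hom_axioms_def)

lemma normal_principal: "principal \<lhd> free_Abelian_group V"
  using subgroup_principal abelian_free_Abelian_group comm_group.subgroup_imp_normal by blast

lemma principal_cmul: "x \<in> principal \<Longrightarrow> frag_cmul k x \<in> principal"
  by (auto simp: laplacian_cmul[symmetric] intro!: imageI order_trans[OF keys_cmul])

lemma divisor_class_pow_eq_one_iff:
  assumes "Poly_Mapping.keys x \<subseteq> V"
  shows "divisor_class x [^]\<^bsub>coker (free_Abelian_group V) (free_Abelian_group V) (laplacian E)\<^esub> (n::nat)
      = \<one>\<^bsub>coker (free_Abelian_group V) (free_Abelian_group V) (laplacian E)\<^esub>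
    \<longleftrightarrow> frag_cmul (int n) x \<in> principal"
  using coker_pow_eq_one_iff[OF _ abelian_free_Abelian_group laplacian_hom, of x n] assms by simp

lemma comm_group_critical_group: "comm_group (critical_group V E)"
  unfolding critical_group_def
  by (intro comm_group_torsion_subgroup comm_group_coker abelian_free_Abelian_group laplacian_hom) simp

text \<open>Expresses torsion on representatives, so that the later arguments can work with divisors
  instead of cosets.\<close>

lemma carrier_critical_group:
  "carrier (critical_group V E) =
    {divisor_class x | x. Poly_Mapping.keys x \<subseteq> V \<and> (\<exists>n::nat. n > 0 \<and> frag_cmul (int n) x \<in> principal)}"
  (is "_ = ?R")
proof -
  let ?C = "coker (free_Abelian_group V) (free_Abelian_group V) (laplacian E)"
  have "carrier (critical_group V E) =
    {Y \<in> divisor_class ` carrier (free_Abelian_group V). \<exists>n::nat. n > 0 \<and> Y [^]\<^bsub>?C\<^esub> n = \<one>\<^bsub>?C\<^esub>}"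
    unfolding critical_group_def torsion_subgroup_def carrier_coker by simp
  also have "\<dots> = divisor_class ` {x \<in> carrier (free_Abelian_group V).
      \<exists>n::nat. n > 0 \<and> divisor_class x [^]\<^bsub>?C\<^esub> n = \<one>\<^bsub>?C\<^esub>}"
    by (fact Collect_image_conj)
  also have "\<dots> = divisor_class ` {x \<in> carrier (free_Abelian_group V).
      \<exists>n::nat. n > 0 \<and> frag_cmul (int n) x \<in> principal}"
    using divisor_class_pow_eq_one_iff
    by (intro arg_cong[of _ _ "image divisor_class"] Collect_cong) (simp cong: conj_cong)
  also have "\<dots> = ?R"
    by (simp add: setcompr_eq_image)
  finally show ?thesis .
qed

lemma divisor_class_eq:
  assumes "Poly_Mapping.keys x \<subseteq> V" "Poly_Mapping.keys y \<subseteq> V" "x - y \<in> principal"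
  shows "divisor_class x = divisor_class y"
proof -
  have "x = (x - y) + y" by simp
  then have "x \<in> divisor_class y"
    using assms(3) unfolding r_coset_def by (metis UN_iff mult_free_Abelian_group singletonI)
  moreover have "y \<in> carrier (free_Abelian_group V)"
    using assms(2) by simp
  ultimately show ?thesis
    using group.repr_independence[OF group_free_Abelian_group _ _ subgroup_principal] by blast
qed

end

section \<open>Connected graphs: harmonic functions and torsion classes\<close>

locale connected_finite_graph = finite_graph +
  assumes connected: "connected_graph V E"
begin

lemma connected_induct [consumes 2, case_names base step]:
  assumes "u \<in> V" "v \<in> V" "Q u" "\<And>x y. {x, y} \<in> E \<Longrightarrow> Q x \<Longrightarrow> Q y"
  shows "Q v"
proof -
  have "(u, v) \<in> {(x, y). {x, y} \<in> E}\<^sup>*"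
    using connected assms(1,2) by (simp add: connected_graph_def)
  then show ?thesis
  proof (induction rule: rtrancl_induct)
    case (step y z)
    then show ?case
      using assms(4)[of y z] by simp
  qed (rule assms(3))
qed

text \<open>The maximum principle: where a harmonic function is maximal it is also maximal at all
  neighbours.\<close>

lemma harmonic_constant:
  assumes "Poly_Mapping.keys x \<subseteq> V" "laplacian E x = 0" "u \<in> V" "v \<in> V"
  shows "poly_mapping.lookup x u = poly_mapping.lookup x v"
proof -
  define m where "m = Max (poly_mapping.lookup x ` V)"
  have le: "poly_mapping.lookup x w \<le> m" if "w \<in> V" for w
    using that finite_V by (simp add: m_def)
  have "m \<in> poly_mapping.lookup x ` V"
    unfolding m_def using finite_V assms(3) by (intro Max_in) auto
  then obtain z where z: "z \<in> V" "poly_mapping.lookup x z = m" by auto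
  have "poly_mapping.lookup x w = m" if "w \<in> V" for w
    using z(1) that
  proof (induction rule: connected_induct)
    case (step a b)
    have "(\<Sum>u\<in>{u. {a, u} \<in> E}. poly_mapping.lookup x a - poly_mapping.lookup x u) = 0"
      using lookup_laplacian[OF assms(1), of a] assms(2) by simp
    moreover have "poly_mapping.lookup x a - poly_mapping.lookup x u \<ge> 0" if "{a, u} \<in> E" for u
      using le[of u] edge_ends[OF that] step by simp
    ultimately have "poly_mapping.lookup x a - poly_mapping.lookup x b = 0"
      using step(1) by (subst (asm) sum_nonneg_eq_0_iff) auto
    then show ?case using step by simp
  qed (use z in simp)
  then show ?thesis using assms(3,4) by simp
qed

text \<open>Together with a divisor \<open>x\<close> and one vertex \<open>q\<close>, the principal divisors of the vertices
  other than \<open>q\<close> are one vector too many to be independent; by the maximum principle \<open>x\<close> takes part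
  in any relation.\<close>

lemma degree_zero_torsion:
  assumes x: "Poly_Mapping.keys x \<subseteq> V" and "deg x = 0"
  obtains n :: nat where "n > 0" "frag_cmul (int n) x \<in> principal"
proof -
  obtain q where q: "q \<in> V"
    using connected by (auto simp: connected_graph_def)
  define f where "f i = (case i of None \<Rightarrow> x | Some v \<Rightarrow> if v = q then frag_of q else laplacian E (frag_of v))" for i
  have "card V < card (insert None (Some ` V))"
    using finite_V by (simp add: card_image)
  then obtain c where c: "\<exists>i\<in>insert None (Some ` V). c i \<noteq> 0"
    and rel: "\<forall>s\<in>V. (\<Sum>i\<in>insert None (Some ` V). c i * poly_mapping.lookup (f i) s) = 0"
    using integral_relation[of V "insert None (Some ` V)" "\<lambda>i. poly_mapping.lookup (f i)"] finite_V by auto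
  define y where "y = (\<Sum>v\<in>V - {q}. frag_cmul (c (Some v)) (frag_of v))"
  define k where "k = c None"
  define m where "m = c (Some q)"
  have y: "Poly_Mapping.keys y \<subseteq> V"
    unfolding y_def by (rule keys_sum_subset) (auto simp: keys_frag_of)
  have y_lookup: "poly_mapping.lookup y v = (if v \<in> V - {q} then c (Some v) else 0)" for v
    using finite_V by (simp add: y_def lookup_sum if_distrib cong: if_cong)
  have Ly: "laplacian E y = (\<Sum>v\<in>V - {q}. frag_cmul (c (Some v)) (f (Some v)))"
    using finite_V by (simp add: y_def laplacian_sum laplacian_cmul f_def)
  have sum0: "frag_cmul k x + frag_cmul m (frag_of q) + laplacian E y = 0"
  proof (rule poly_mapping_eqI)
    fix s
    show "poly_mapping.lookup (frag_cmul k x + frag_cmul m (frag_of q) + laplacian E y) s = poly_mapping.lookup 0 s"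
    proof (cases "s \<in> V")
      case True
      have "(\<Sum>i\<in>insert None (Some ` V). c i * poly_mapping.lookup (f i) s)
        = c None * poly_mapping.lookup (f None) s + (\<Sum>v\<in>V. c (Some v) * poly_mapping.lookup (f (Some v)) s)"
        using finite_V by (simp add: sum.reindex)
      also have "(\<Sum>v\<in>V. c (Some v) * poly_mapping.lookup (f (Some v)) s)
        = m * poly_mapping.lookup (frag_of q) s + (\<Sum>v\<in>V - {q}. c (Some v) * poly_mapping.lookup (f (Some v)) s)"
        using finite_V q by (simp add: sum.remove m_def f_def)
      finally show ?thesis
        using rel True by (simp add: lookup_add Ly lookup_sum k_def f_def)
    next
      case False
      have "poly_mapping.lookup z s = 0" if "Poly_Mapping.keys z \<subseteq> V" for z :: "'a \<Rightarrow>\<^sub>0 int"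
        using that False by (auto simp: in_keys_iff)
      then show ?thesis
        using x q keys_laplacian[OF y] False by (auto simp: lookup_add)
    qed
  qed
  \<comment> \<open>Degrees isolate \<open>m\<close>: both \<open>x\<close> and
    \<open>laplacian E y\<close> have degree 0, while the generator at \<open>q\<close> has degree
    1.\<close>
  have "deg (frag_cmul k x + frag_cmul m (frag_of q) + laplacian E y) = 0"
    unfolding sum0 by (simp add: deg_def)
  then have m: "m = 0"
    using assms(2) q by (simp add: deg_add deg_cmul deg_frag_of deg_laplacian[OF y])
  have "k \<noteq> 0"
  proof
    assume k: "k = 0"
    then have "laplacian E y = 0"
      using sum0 m by simp
    \<comment> \<open>A harmonic \<open>y\<close> is constant, and it vanishes at \<open>q\<close>
      by construction. So every coefficient of the relation would be 0.\<close>
    then have "poly_mapping.lookup y v = 0" if "v \<in> V" for v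
      using harmonic_constant[OF y _ that q] y_lookup[of q] by simp
    then have "c i = 0" if "i \<in> insert None (Some ` V)" for i
      using that k m y_lookup by (auto simp: k_def m_def split: if_splits) (metis DiffI singletonD)
    then show False using c by blast
  qed
  moreover have "frag_cmul (int (nat \<bar>k\<bar>)) x \<in> principal"
  proof -
    have "frag_cmul k x = - laplacian E y"
      using sum0 unfolding m by (simp add: eq_neg_iff_add_eq_0)
    then have "frag_cmul k x = laplacian E (- y)"
      using laplacian_diff[of E 0 y] by simp
    then have "frag_cmul k x \<in> principal"
      using y by (auto simp: keys_minus)
    \<comment> \<open>The sign of \<open>k\<close> is unknown; multiplying by it gives a positive
      multiple.\<close>
    then have "frag_cmul (sgn k) (frag_cmul k x) \<in> principal"
      by (rule principal_cmul)
    moreover have "sgn k * k = int (nat \<bar>k\<bar>)"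
      by (simp add: sgn_if)
    ultimately show ?thesis by simp
  qed
  ultimately show thesis
    by (intro that[of "nat \<bar>k\<bar>"]) auto
qed

lemma torsion_iff_degree_zero:
  assumes "Poly_Mapping.keys x \<subseteq> V"
  shows "(\<exists>n::nat. n > 0 \<and> frag_cmul (int n) x \<in> principal) \<longleftrightarrow> deg x = 0"
proof
  assume "\<exists>n::nat. n > 0 \<and> frag_cmul (int n) x \<in> principal"
  then obtain n :: nat and c where "n > 0" "Poly_Mapping.keys c \<subseteq> V" "frag_cmul (int n) x = laplacian E c"
    by auto
  then show "deg x = 0"
    using deg_laplacian[of c] deg_cmul[of "int n" x] by simp
qed (use degree_zero_torsion[OF assms] in blast)

end

section \<open>Incidence maps and the line graph\<close>

text \<open>Meant for the edges at the two ends of \<open>e\<close>: the edge \<open>e\<close> is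
  counted in both sets and has to be removed twice.\<close>

lemma sum_insert_incident:
  fixes f :: "'a \<Rightarrow> 'b::ab_group_add"
  assumes "finite A" "finite B" "A \<inter> B = {e}"
  shows "sum f (A \<union> B - {e}) = sum f A + sum f B - f e - f e"
proof -
  have "sum f (A \<union> B) + f e = sum f A + sum f B"
    using sum.union_inter[OF assms(1,2), of f] assms(3) by simp
  moreover have "sum f (A \<union> B) = f e + sum f (A \<union> B - {e})"
    using assms by (intro sum.remove) auto
  ultimately show ?thesis
    by (simp add: algebra_simps)
qed

context finite_graph
begin

definition star :: "'a \<Rightarrow> ('a set \<Rightarrow>\<^sub>0 int)" where
  "star v = (\<Sum>e\<in>{e \<in> E. v \<in> e}. frag_of e)"

text \<open>The unsigned incidence matrix with its rows scaled by the vertex weights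
  \<open>\<omega>\<close>; \<open>up \<omega>\<close> is its transpose.\<close>

definition down :: "('a \<Rightarrow> int) \<Rightarrow> ('a set \<Rightarrow>\<^sub>0 int) \<Rightarrow> ('a \<Rightarrow>\<^sub>0 int)" where
  "down \<omega> = frag_extend (\<lambda>e. \<Sum>v\<in>e. frag_cmul (\<omega> v) (frag_of v))"

definition up :: "('a \<Rightarrow> int) \<Rightarrow> ('a \<Rightarrow>\<^sub>0 int) \<Rightarrow> ('a set \<Rightarrow>\<^sub>0 int)" where
  "up \<omega> = frag_extend (\<lambda>v. frag_cmul (\<omega> v) (star v))"

lemma finite_incident [simp]: "finite {e \<in> E. v \<in> e}"
  using finite_E by simp

lemma down_diff: "down \<omega> (x - y) = down \<omega> x - down \<omega> y"
  by (simp add: down_def frag_extend_diff)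

lemma down_add: "down \<omega> (x + y) = down \<omega> x + down \<omega> y"
  by (simp add: down_def frag_extend_add)

lemma down_cmul: "down \<omega> (frag_cmul k x) = frag_cmul k (down \<omega> x)"
  by (simp add: down_def frag_extend_cmul)

lemma up_diff: "up \<omega> (x - y) = up \<omega> x - up \<omega> y"
  by (simp add: up_def frag_extend_diff)

lemma up_add: "up \<omega> (x + y) = up \<omega> x + up \<omega> y"
  by (simp add: up_def frag_extend_add)

lemma up_cmul: "up \<omega> (frag_cmul k x) = frag_cmul k (up \<omega> x)"
  by (simp add: up_def frag_extend_cmul)

lemma up_sum: "finite I \<Longrightarrow> up \<omega> (sum f I) = (\<Sum>i\<in>I. up \<omega> (f i))"
  by (simp add: up_def frag_extend_sum o_def)

lemma up_frag_of: "up \<omega> (frag_of v) = frag_cmul (\<omega> v) (star v)"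
  by (simp add: up_def)

lemma down_edge:
  "{v, w} \<in> E \<Longrightarrow> down \<omega> (frag_of {v, w}) = frag_cmul (\<omega> v) (frag_of v) + frag_cmul (\<omega> w) (frag_of w)"
  using edge_ends[of v w] by (simp add: down_def)

lemma star_neighbours: "star v = (\<Sum>u\<in>{u. {v, u} \<in> E}. frag_of {v, u})"
  unfolding star_def by (rule sum_incident)

text \<open>Each edge at \<open>v\<close> contributes \<open>v\<close> and its other end. For
  constant weight 1 this is the signless Laplacian.\<close>

lemma down_star:
  "down \<omega> (star v) = frag_cmul (\<omega> v * int (degree E v)) (frag_of v)
    + (\<Sum>u\<in>{u. {v, u} \<in> E}. frag_cmul (\<omega> u) (frag_of u))"
proof -
  have "down \<omega> (star v) = (\<Sum>u\<in>{u. {v, u} \<in> E}. down \<omega> (frag_of {v, u}))"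
    unfolding star_neighbours by (simp add: down_def frag_extend_sum o_def)
  also have "\<dots> = (\<Sum>u\<in>{u. {v, u} \<in> E}. frag_cmul (\<omega> v) (frag_of v))
      + (\<Sum>u\<in>{u. {v, u} \<in> E}. frag_cmul (\<omega> u) (frag_of u))"
    unfolding sum.distrib[symmetric] by (rule sum.cong) (auto simp: down_edge)
  also have "(\<Sum>u\<in>{u. {v, u} \<in> E}. frag_cmul (\<omega> v) (frag_of v))
      = frag_cmul (\<omega> v * int (degree E v)) (frag_of v)"
    by (rule poly_mapping_eqI) (simp add: lookup_sum card_neighbours)
  finally show ?thesis .
qed

lemma edgeE:
  assumes "e \<in> E"
  obtains v w where "e = {v, w}" "v \<in> V" "w \<in> V" "v \<noteq> w"
proof -
  have "card e = 2"
    using assms graph by (simp add: simple_graph_def)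
  then obtain v w where "e = {v, w}" "v \<noteq> w"
    by (auto simp: card_2_iff)
  then show thesis
    using that edge_subset[OF assms] by simp
qed

lemma keys_star: "Poly_Mapping.keys (star v) \<subseteq> E"
  unfolding star_def by (rule keys_sum_subset) (simp add: keys_frag_of)

lemma keys_up: "Poly_Mapping.keys (up \<omega> x) \<subseteq> E"
proof -
  have "(\<Union>v\<in>Poly_Mapping.keys x. Poly_Mapping.keys (frag_cmul (\<omega> v) (star v))) \<subseteq> E"
    using keys_star by auto
  then show ?thesis
    unfolding up_def by (rule order_trans[OF keys_frag_extend])
qed

lemma keys_down:
  assumes "Poly_Mapping.keys x \<subseteq> E"
  shows "Poly_Mapping.keys (down \<omega> x) \<subseteq> V"
proof -
  have "Poly_Mapping.keys (\<Sum>v\<in>e. frag_cmul (\<omega> v) (frag_of v)) \<subseteq> V" if "e \<in> E" for e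
    using edge_subset[OF that] by (intro keys_sum_subset order_trans[OF keys_cmul]) (auto simp: keys_frag_of)
  then have "(\<Union>e\<in>Poly_Mapping.keys x. Poly_Mapping.keys (\<Sum>v\<in>e. frag_cmul (\<omega> v) (frag_of v))) \<subseteq> V"
    using assms by blast
  then show ?thesis
    unfolding down_def by (rule order_trans[OF keys_frag_extend])
qed

lemma down_hom: "down \<omega> \<in> hom (free_Abelian_group E) (free_Abelian_group V)"
  by (rule hom_free_Abelian_groupI) (simp_all add: down_add keys_down)

section \<open>The Laplacian of the line graph\<close>

lemma simple_graph_line: "simple_graph E (line_edges E)"
  using finite_E by (auto simp: simple_graph_def line_edges_def card_2_iff)

lemma line_neighbours:
  assumes "{v, w} \<in> E"
  shows "{f. {{v, w}, f} \<in> line_edges E} = {e \<in> E. v \<in> e} \<union> {e \<in> E. w \<in> e} - {{v, w}}"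
proof (intro equalityI subsetI)
  fix f assume "f \<in> {f. {{v, w}, f} \<in> line_edges E}"
  then obtain a b where ab: "{{v, w}, f} = {a, b}" "a \<in> E" "b \<in> E" "a \<noteq> b" "a \<inter> b \<noteq> {}"
    by (auto simp: line_edges_def)
  then have "a = {v, w} \<and> b = f \<or> a = f \<and> b = {v, w}"
    by (metis doubleton_eq_iff)
  then show "f \<in> {e \<in> E. v \<in> e} \<union> {e \<in> E. w \<in> e} - {{v, w}}"
    using ab by auto
next
  fix f assume "f \<in> {e \<in> E. v \<in> e} \<union> {e \<in> E. w \<in> e} - {{v, w}}"
  then have "f \<in> E" "{v, w} \<noteq> f" "{v, w} \<inter> f \<noteq> {}"
    by auto
  then show "f \<in> {f. {{v, w}, f} \<in> line_edges E}"
    using assms unfolding line_edges_def by blast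
qed

lemma incident_both:
  assumes "{v, w} \<in> E"
  shows "{e \<in> E. v \<in> e} \<inter> {e \<in> E. w \<in> e} = {{v, w}}"
proof -
  have both: "e = {v, w}" if e: "e \<in> E" "v \<in> e" "w \<in> e" for e
  proof -
    obtain a b where "e = {a, b}"
      using edgeE[OF e(1)] by metis
    then show ?thesis
      using e edge_ends[OF assms] by auto
  qed
  show ?thesis
  proof (intro equalityI subsetI)
    fix e assume "e \<in> {e \<in> E. v \<in> e} \<inter> {e \<in> E. w \<in> e}"
    then show "e \<in> {{v, w}}"
      using both[of e] by simp
  qed (use assms in simp)
qed

text \<open>The neighbours of an edge are the edges of the two stars without the edge itself, which
  occurs in both. The two surplus copies cancel against the 2 by which the degree in the line graph
  falls short of the sum of the end degrees.\<close>

lemma line_laplacian_edge: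
  assumes "{v, w} \<in> E"
  shows "laplacian (line_edges E) (frag_of {v, w}) =
    frag_cmul (int (degree E v) + int (degree E w)) (frag_of {v, w}) - star v - star w"
proof -
  interpret line: finite_graph E "line_edges E"
    by unfold_locales (rule simple_graph_line)
  have sum: "sum f {f. {{v, w}, f} \<in> line_edges E}
      = sum f {e \<in> E. v \<in> e} + sum f {e \<in> E. w \<in> e} - f {v, w} - f {v, w}"
    for f :: "'a set \<Rightarrow> 'b::ab_group_add"
    unfolding line_neighbours[OF assms] using incident_both[OF assms]
    by (intro sum_insert_incident) simp_all
  \<comment> \<open>The same summation formula, applied to the constant 1, counts the
    neighbours.\<close>
  have "int (degree (line_edges E) {v, w}) = int (degree E v) + int (degree E w) - 2"
    using sum[of "\<lambda>_. 1::int"] by (simp add: line.card_neighbours degree_def[of E])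
  then show ?thesis
    unfolding laplacian_frag_of sum star_def
    by (simp add: frag_cmul_diff_distrib frag_cmul_distrib)
      (rule poly_mapping_eqI, simp add: lookup_minus lookup_add)
qed

end

section \<open>Semiregular bipartite graphs\<close>

lemma mult_div_gcd_eq_lcm:
  fixes m n :: nat
  shows "m * (n div gcd m n) = lcm m n" "n * (m div gcd m n) = lcm m n"
  by (simp_all add: lcm_nat_def div_mult_swap mult.commute[of m n])

locale semiregular_graph = connected_finite_graph +
  fixes V1 V2 d1 d2
  assumes semiregular: "semiregular_bipartite V E V1 V2 d1 d2"
begin

sublocale line: finite_graph E "line_edges E"
  by unfold_locales (rule simple_graph_line)

text \<open>Crossing an edge exchanges \<open>wt\<close> and \<open>cowt\<close>, and their product
  is the constant \<open>wt_prod\<close>. All identities below rest on these two facts; dividing by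
  the gcd is what makes lcm appear in place of the product of the degrees.\<close>

definition wt :: "'a \<Rightarrow> int" where
  "wt v = int ((if v \<in> V1 then d1 else d2) div gcd d1 d2)"

definition cowt :: "'a \<Rightarrow> int" where
  "cowt v = int ((if v \<in> V1 then d2 else d1) div gcd d1 d2)"

definition wt_prod :: int where
  "wt_prod = int ((d1 div gcd d1 d2) * (d2 div gcd d1 d2))"

lemma degree_eq: "v \<in> V \<Longrightarrow> degree E v = (if v \<in> V1 then d1 else d2)"
  using semiregular by (auto simp: semiregular_bipartite_def bipartition_def)

lemma edge_sides: "{v, w} \<in> E \<Longrightarrow> w \<in> V1 \<longleftrightarrow> v \<notin> V1"
  using semiregular unfolding semiregular_bipartite_def bipartition_def
  by (metis disjoint_iff doubleton_eq_iff)

lemma wt_neighbour: "{v, w} \<in> E \<Longrightarrow> wt w = cowt v"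
  and cowt_neighbour: "{v, w} \<in> E \<Longrightarrow> cowt w = wt v"
  using edge_sides[of v w] by (auto simp: wt_def cowt_def)

lemma degree_add_neighbour: "{v, w} \<in> E \<Longrightarrow> degree E v + degree E w = d1 + d2"
  using edge_sides[of v w] edge_ends[of v w] by (auto simp: degree_eq)

lemma wt_cowt: "wt v * cowt v = wt_prod"
  by (simp add: wt_def cowt_def wt_prod_def)

lemma cowt_degree:
  assumes "v \<in> V"
  shows "cowt v * int (degree E v) = int (lcm d1 d2)"
proof -
  have "cowt v * int (degree E v) =
      int (if v \<in> V1 then d1 * (d2 div gcd d1 d2) else d2 * (d1 div gcd d1 d2))"
    unfolding cowt_def degree_eq[OF assms] of_nat_mult[symmetric]
    by (simp only: if_distrib mult.commute split: if_split) simp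
  then show ?thesis
    by (simp only: mult_div_gcd_eq_lcm if_cancel)
qed

text \<open>\<open>d1 + d2 - degree E v\<close> is the degree on the opposite side, so both products
  are the lcm. This matches the diagonal coefficients in the identities below.\<close>

lemma wt_codegree:
  assumes "v \<in> V"
  shows "(int (d1 + d2) - int (degree E v)) * wt v = cowt v * int (degree E v)"
proof -
  have "int (d1 + d2) - int (degree E v) = int (if v \<in> V1 then d2 else d1)"
    using assms by (simp add: degree_eq)
  then have "(int (d1 + d2) - int (degree E v)) * wt v
      = int (if v \<in> V1 then d2 * (d1 div gcd d1 d2) else d1 * (d2 div gcd d1 d2))"
    by (simp only: wt_def of_nat_mult split: if_split) simp
  then show ?thesis
    unfolding cowt_degree[OF assms] by (simp only: mult_div_gcd_eq_lcm if_cancel)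
qed

text \<open>With \<open>d1 = h * a\<close> and \<open>d2 = h * b\<close> both sides are
  \<open>h * a * b * (a + b)\<close>; if the gcd is 0, both vanish.\<close>

lemma wt_prod_degrees: "wt_prod * int (d1 + d2) = int ((d1 + d2) div gcd d1 d2 * lcm d1 d2)"
proof (cases "gcd d1 d2 = 0")
  case False
  define h where "h = gcd d1 d2"
  obtain a b where ab: "d1 = h * a" "d2 = h * b"
    unfolding h_def by (meson dvdE gcd_dvd1 gcd_dvd2)
  have "h \<noteq> 0" using False h_def by simp
  moreover have "lcm d1 d2 = h * a * b"
    using \<open>h \<noteq> 0\<close> by (simp add: lcm_nat_def flip: h_def) (simp add: ab)
  moreover have "(d1 + d2) div h = a + b"
    using \<open>h \<noteq> 0\<close> by (simp add: ab flip: distrib_left)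
  ultimately have "d1 div h * (d2 div h) * (d1 + d2) = (d1 + d2) div h * lcm d1 d2"
    by (simp add: ab algebra_simps)
  then show ?thesis
    unfolding wt_prod_def h_def by (metis of_nat_mult)
qed (simp add: wt_prod_def)

section \<open>Identities between the incidence maps and the two Laplacians\<close>

lemma laplacian_cowt:
  assumes "v \<in> V"
  shows "laplacian E (frag_cmul (cowt v) (frag_of v))
    = frag_cmul (int (d1 + d2) * wt v) (frag_of v) - down wt (star v)"
proof -
  \<comment> \<open>All neighbours of \<open>v\<close> carry the weight \<open>cowt v\<close>, so
    the neighbour terms of \<open>down wt (star v)\<close> cancel those of the Laplacian and only a
    multiple of \<open>v\<close> is left.\<close>
  have "(\<Sum>u\<in>{u. {v, u} \<in> E}. frag_cmul (wt u) (frag_of u))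
    = frag_cmul (cowt v) (\<Sum>u\<in>{u. {v, u} \<in> E}. frag_of u)"
    unfolding frag_cmul_sum by (rule sum.cong) (auto simp: wt_neighbour)
  moreover have "cowt v * int (degree E v) = int (d1 + d2) * wt v - wt v * int (degree E v)"
    unfolding wt_codegree[OF assms, symmetric] by (simp add: algebra_simps)
  ultimately show ?thesis
    by (simp add: laplacian_cmul laplacian_frag_of down_star frag_cmul_diff_right
        frag_cmul_diff_distrib)
qed

lemma line_laplacian_edge':
  assumes "{v, w} \<in> E"
  shows "laplacian (line_edges E) (frag_of {v, w})
    = frag_cmul (int (d1 + d2)) (frag_of {v, w}) - star v - star w"
  using line_laplacian_edge[OF assms] degree_add_neighbour[OF assms] by (metis of_nat_add)

text \<open>On an edge the left side splits into one contribution per end, and each is an instance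
  of \<open>laplacian_cowt\<close>.\<close>

lemma down_line_laplacian:
  assumes "Poly_Mapping.keys x \<subseteq> E"
  shows "down wt (laplacian (line_edges E) x) = laplacian E (down cowt x)"
  using assms
proof (rule frag_linear_eq)
  fix e assume "e \<in> E"
  then obtain v w where e: "e = {v, w}" "{v, w} \<in> E" "v \<in> V" "w \<in> V"
    by (metis edgeE)
  have "down wt (laplacian (line_edges E) (frag_of e)) =
      frag_cmul (int (d1 + d2)) (down wt (frag_of e)) - down wt (star v) - down wt (star w)"
    unfolding e(1) line_laplacian_edge'[OF e(2)] down_diff down_cmul ..
  also have "frag_cmul (int (d1 + d2)) (down wt (frag_of e)) =
      frag_cmul (int (d1 + d2) * wt v) (frag_of v) + frag_cmul (int (d1 + d2) * wt w) (frag_of w)"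
    unfolding e(1) down_edge[OF e(2)] frag_cmul_distrib2 frag_cmul_cmul ..
  finally show "down wt (laplacian (line_edges E) (frag_of e)) = laplacian E (down cowt (frag_of e))"
    unfolding e(1) down_edge[OF e(2)] laplacian_add laplacian_cowt[OF e(3)] laplacian_cowt[OF e(4)]
    by simp
qed (simp_all add: laplacian_diff down_diff)

text \<open>At a vertex \<open>v\<close> both sides equal \<open>wt v\<close> times the same
  combination of \<open>star v\<close> and the stars of the neighbours of \<open>v\<close>.\<close>

lemma up_laplacian:
  assumes "Poly_Mapping.keys x \<subseteq> V"
  shows "up cowt (laplacian E x) = laplacian (line_edges E) (up wt x)"
  using assms
proof (rule frag_linear_eq)
  fix v assume v: "v \<in> V"
  let ?N = "{u. {v, u} \<in> E}" and ?D = "int (d1 + d2)"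
  have "up cowt (laplacian E (frag_of v)) =
      frag_cmul (int (degree E v) * cowt v) (star v) - (\<Sum>u\<in>?N. frag_cmul (cowt u) (star u))"
    by (simp add: laplacian_frag_of up_diff up_cmul up_sum up_frag_of)
  also have "(\<Sum>u\<in>?N. frag_cmul (cowt u) (star u)) = frag_cmul (wt v) (\<Sum>u\<in>?N. star u)"
    unfolding frag_cmul_sum by (rule sum.cong) (auto simp: cowt_neighbour)
  also have "int (degree E v) * cowt v = wt v * (?D - int (degree E v))"
    using wt_codegree[OF v] by (simp add: mult.commute)
  finally have 1: "up cowt (laplacian E (frag_of v)) =
      frag_cmul (wt v) (frag_cmul (?D - int (degree E v)) (star v) - (\<Sum>u\<in>?N. star u))"
    by (simp add: frag_cmul_diff_right)
  have "laplacian (line_edges E) (star v) =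
      (\<Sum>u\<in>?N. frag_cmul ?D (frag_of {v, u}) - star v - star u)"
    unfolding star_neighbours[of v] laplacian_sum[OF finite_neighbours]
    by (rule sum.cong) (auto simp: line_laplacian_edge' star_neighbours[of v])
  also have "\<dots> = frag_cmul ?D (star v) - (\<Sum>u\<in>?N. star v) - (\<Sum>u\<in>?N. star u)"
    by (simp add: sum_subtractf star_neighbours[of v] frag_cmul_sum)
  also have "(\<Sum>u\<in>?N. star v) = frag_cmul (int (degree E v)) (star v)"
    by (rule poly_mapping_eqI) (simp add: lookup_sum card_neighbours)
  finally have 2: "laplacian (line_edges E) (star v) =
      frag_cmul (?D - int (degree E v)) (star v) - (\<Sum>u\<in>?N. star u)"
    by (simp only: frag_cmul_diff_distrib)
  show "up cowt (laplacian E (frag_of v)) = laplacian (line_edges E) (up wt (frag_of v))"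
    unfolding 1 up_frag_of laplacian_cmul 2 ..
qed (simp_all add: laplacian_diff up_diff)

text \<open>Going down and up along an edge multiplies the star of either end by
  \<open>wt * cowt = wt_prod\<close>, and the line Laplacian expresses the sum of the two
  stars.\<close>

lemma up_down:
  assumes "Poly_Mapping.keys x \<subseteq> E"
  shows "up cowt (down wt x)
    = frag_cmul wt_prod (frag_cmul (int (d1 + d2)) x - laplacian (line_edges E) x)"
  using assms
proof (rule frag_linear_eq)
  fix e assume "e \<in> E"
  then obtain v w where e: "e = {v, w}" "{v, w} \<in> E"
    by (metis edgeE)
  show "up cowt (down wt (frag_of e))
    = frag_cmul wt_prod (frag_cmul (int (d1 + d2)) (frag_of e) - laplacian (line_edges E) (frag_of e))"
    unfolding e(1) down_edge[OF e(2)] line_laplacian_edge'[OF e(2)]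
    by (simp add: up_add up_cmul up_frag_of wt_cowt frag_cmul_distrib2)
qed (simp_all add: laplacian_diff up_diff down_diff frag_cmul_diff_right)

section \<open>The exponent of the kernel\<close>

lemma down_principal_imp:
  assumes x: "Poly_Mapping.keys x \<subseteq> E" and "down wt x \<in> principal"
  shows "frag_cmul (int ((d1 + d2) div gcd d1 d2 * lcm d1 d2)) x \<in> line.principal"
proof -
  obtain c where c: "Poly_Mapping.keys c \<subseteq> V" "down wt x = laplacian E c"
    using assms(2) by auto
  \<comment> \<open>\<open>up_down\<close> is solved for the multiple of \<open>x\<close>; with
    \<open>down wt x = laplacian E c\<close>, both remaining terms are line Laplacians.\<close>
  have "frag_cmul wt_prod (frag_cmul (int (d1 + d2)) x) =
      up cowt (down wt x) + frag_cmul wt_prod (laplacian (line_edges E) x)"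
    unfolding up_down[OF x] by (simp add: frag_cmul_diff_right)
  also have "\<dots> = laplacian (line_edges E) (up wt c + frag_cmul wt_prod x)"
    unfolding c(2) up_laplacian[OF c(1)] by (simp add: laplacian_add laplacian_cmul)
  finally have "frag_cmul (wt_prod * int (d1 + d2)) x = laplacian (line_edges E) (up wt c + frag_cmul wt_prod x)"
    by simp
  moreover have "Poly_Mapping.keys (up wt c + frag_cmul wt_prod x) \<subseteq> E"
    using keys_up x by (intro order_trans[OF keys_add] Un_least order_trans[OF keys_cmul])
  ultimately show ?thesis
    unfolding wt_prod_degrees by (intro image_eqI) simp_all
qed

text \<open>An edge forces both degrees to be positive. Positivity is needed to conclude from the
  kernel bound that a class is torsion.\<close>

lemma exponent_pos:
  assumes "E \<noteq> {}"
  shows "(d1 + d2) div gcd d1 d2 * lcm d1 d2 > 0"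
proof -
  obtain e where "e \<in> E" using assms by blast
  moreover have "\<forall>e\<in>E. \<exists>u\<in>V1. \<exists>v\<in>V2. e = {u, v}"
    using semiregular by (simp add: semiregular_bipartite_def bipartition_def)
  ultimately obtain u v where uv: "u \<in> V1" "v \<in> V2" "{u, v} \<in> E"
    by metis
  have "degree E w > 0" if "w \<in> {u, v}" for w
    using uv(3) that unfolding degree_def by (subst card_gt_0_iff) auto
  moreover have "degree E u = d1" "degree E v = d2"
    using uv(1) edge_sides[OF uv(3)] edge_ends[OF uv(3)] by (simp_all add: degree_eq)
  ultimately have pos: "d1 > 0" "d2 > 0"
    by auto
  then have "gcd d1 d2 \<le> d1"
    by (intro gcd_le1_nat) simp
  then have "gcd d1 d2 \<le> d1 + d2"
    by linarith
  then show ?thesis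
    using pos by (simp add: div_greater_zero_iff lcm_pos_nat)
qed

section \<open>The exponent of the cokernel\<close>

lemma edge_difference:
  assumes "{u, v} \<in> E"
  obtains z where "Poly_Mapping.keys z \<subseteq> E"
    "frag_cmul (int (lcm d1 d2)) (frag_of u - frag_of v) - down wt z \<in> principal"
proof
  \<comment> \<open>Modulo principal divisors \<open>down wt (star u)\<close> is
    \<open>(d1 + d2) * wt u\<close> times \<open>u\<close>. Removing the edge
    \<open>degree E u\<close> times leaves \<open>lcm d1 d2\<close> copies of \<open>u\<close> and
    subtracts as many copies of \<open>v\<close>.\<close>
  let ?z = "star u - frag_cmul (int (degree E u)) (frag_of {u, v})"
  have u: "u \<in> V" using edge_ends[OF assms] by simp
  show "Poly_Mapping.keys ?z \<subseteq> E"
  proof -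
    have "Poly_Mapping.keys (frag_cmul (int (degree E u)) (frag_of {u, v})) \<subseteq> E"
      using assms by (auto simp: keys_frag_of)
    then show ?thesis
      by (intro order_trans[OF keys_diff] Un_least keys_star)
  qed
  have "frag_cmul (int (lcm d1 d2)) (frag_of u - frag_of v) - down wt ?z
      = laplacian E (frag_cmul (cowt u) (frag_of u))"
  proof -
    have "down wt ?z = down wt (star u)
        - frag_cmul (int (degree E u) * wt u) (frag_of u) - frag_cmul (int (lcm d1 d2)) (frag_of v)"
      using cowt_degree[OF u]
      by (simp add: down_diff down_cmul down_edge[OF assms] frag_cmul_distrib2 wt_neighbour[OF assms] mult.commute)
    moreover have "int (d1 + d2) * wt u = int (lcm d1 d2) + int (degree E u) * wt u"
      using wt_codegree[OF u] cowt_degree[OF u] by (simp add: algebra_simps)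
    ultimately show ?thesis
      unfolding laplacian_cowt[OF u] by (simp add: frag_cmul_diff_right frag_cmul_distrib)
  qed
  then show "frag_cmul (int (lcm d1 d2)) (frag_of u - frag_of v) - down wt ?z \<in> principal"
    using u by (intro image_eqI) (auto simp: keys_frag_of)
qed

text \<open>The divisors with the desired property form a subgroup \<open>H\<close>. It contains the
  differences along edges, hence by connectedness all \<open>v - q\<close>, and these generate the
  divisors of degree 0.\<close>

lemma degree_zero_lcm:
  assumes x: "Poly_Mapping.keys x \<subseteq> V" and "deg x = 0"
  obtains z where "Poly_Mapping.keys z \<subseteq> E"
    "frag_cmul (int (lcm d1 d2)) x - down wt z \<in> principal"
proof -
  define H where "H = {x. \<exists>z. Poly_Mapping.keys z \<subseteq> E \<and>
    frag_cmul (int (lcm d1 d2)) x - down wt z \<in> principal}"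
  have H_diff: "x - y \<in> H" if xy: "x \<in> H" "y \<in> H" for x y
  proof -
    obtain z z' c c' where z: "Poly_Mapping.keys z \<subseteq> E" "Poly_Mapping.keys z' \<subseteq> E"
        "Poly_Mapping.keys c \<subseteq> V" "Poly_Mapping.keys c' \<subseteq> V"
        "frag_cmul (int (lcm d1 d2)) x - down wt z = laplacian E c"
        "frag_cmul (int (lcm d1 d2)) y - down wt z' = laplacian E c'"
      using xy unfolding H_def by (elim CollectE exE conjE imageE) simp
    have "frag_cmul (int (lcm d1 d2)) (x - y) - down wt (z - z') = laplacian E (c - c')"
      by (simp add: laplacian_diff flip: z(5,6)) (simp add: frag_cmul_diff_right down_diff)
    moreover have "Poly_Mapping.keys (z - z') \<subseteq> E" "Poly_Mapping.keys (c - c') \<subseteq> V"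
      using z by (meson Un_least keys_diff order_trans)+
    ultimately show ?thesis
      unfolding H_def by (intro CollectI exI[of _ "z - z'"] conjI image_eqI[of _ _ "c - c'"]) simp_all
  qed
  have H_0: "0 \<in> H"
    by (unfold H_def, intro CollectI exI[of _ 0] conjI image_eqI[of _ _ 0]) (simp_all add: down_def)
  obtain q where q: "q \<in> V"
    using connected by (auto simp: connected_graph_def)
  have H_edge: "frag_of u - frag_of v \<in> H" if uv: "{u, v} \<in> E" for u v
  proof -
    obtain z where "Poly_Mapping.keys z \<subseteq> E"
        "frag_cmul (int (lcm d1 d2)) (frag_of u - frag_of v) - down wt z \<in> principal"
      by (rule edge_difference[OF uv])
    then show ?thesis
      unfolding H_def by (intro CollectI exI[of _ z] conjI)
  qed
  have H_vertex: "frag_of v - frag_of q \<in> H" if "v \<in> V" for v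
    using q that
  proof (induction rule: connected_induct)
    case (step a b)
    then show ?case
      using H_diff[OF step(2) H_edge[OF step(1)]] by simp
  qed (simp add: H_0)
  \<comment> \<open>Correcting by a multiple of \<open>q\<close> gives a statement about divisors of
    any degree, which is open to induction.\<close>
  have "x - frag_cmul (deg x) (frag_of q) \<in> H"
    using x
  proof (rule free_Abelian_group_induct)
    fix x y
    assume "x - frag_cmul (deg x) (frag_of q) \<in> H" "y - frag_cmul (deg y) (frag_of q) \<in> H"
    then show "x - y - frag_cmul (deg (x - y)) (frag_of q) \<in> H"
      using H_diff[of "x - frag_cmul (deg x) (frag_of q)" "y - frag_cmul (deg y) (frag_of q)"]
      by (simp add: deg_diff frag_cmul_diff_distrib algebra_simps)
  next
    show "0 - frag_cmul (deg 0) (frag_of q) \<in> H"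
      using H_0 by (simp add: deg_def)
  qed (simp add: deg_frag_of H_vertex)
  then have "x \<in> H"
    using assms(2) by simp
  then show thesis
    unfolding H_def by (elim CollectE exE conjE) (rule that)
qed

section \<open>The induced homomorphism of critical groups\<close>

lemma down_principal: "down wt ` line.principal \<subseteq> principal"
proof
  fix y assume "y \<in> down wt ` line.principal"
  then obtain x where x: "Poly_Mapping.keys x \<subseteq> E" "y = down wt (laplacian (line_edges E) x)"
    by auto
  then have "y = laplacian E (down cowt x)"
    by (simp add: down_line_laplacian)
  then show "y \<in> principal"
    using keys_down[OF x(1)] by (intro image_eqI) simp_all
qed

text \<open>A positive multiple of \<open>down wt x\<close> is principal since its degree is 0; the
  kernel bound then applies to that multiple of \<open>x\<close>. This ensures that preimages found
  on the level of divisors lie in the critical group.\<close>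

lemma down_torsion:
  assumes x: "Poly_Mapping.keys x \<subseteq> E" and "deg (down wt x) = 0"
  obtains n :: nat where "n > 0" "frag_cmul (int n) x \<in> line.principal"
proof (cases "E = {}")
  \<comment> \<open>Without edges the exponent may be 0, but then \<open>x\<close> is 0.\<close>
  case True
  then have "frag_cmul (int 1) x \<in> line.principal"
    using x by (intro image_eqI[of _ _ 0]) simp_all
  then show thesis
    by (rule that[rotated]) simp
next
  case False
  obtain k :: nat where k: "k > 0" "frag_cmul (int k) (down wt x) \<in> principal"
    using degree_zero_torsion[OF keys_down[OF x] assms(2)] by metis
  define N where "N = (d1 + d2) div gcd d1 d2 * lcm d1 d2"
  have "frag_cmul (int N) (frag_cmul (int k) x) \<in> line.principal"
    unfolding N_def using k(2) x
    by (intro down_principal_imp order_trans[OF keys_cmul]) (simp_all add: down_cmul)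
  then have "frag_cmul (int (N * k)) x \<in> line.principal"
    by simp
  moreover have "N * k > 0"
    using exponent_pos[OF False] k(1) by (simp add: N_def)
  ultimately show thesis
    by (intro that[of "N * k"])
qed

lemma critical_group_hom:
  obtains g where "g \<in> hom (critical_group E (line_edges E)) (critical_group V E)"
    and "all_torsion (lcm d1 d2) (coker (critical_group E (line_edges E)) (critical_group V E) g)"
    and "all_torsion ((d1 + d2) div gcd d1 d2 * lcm d1 d2)
      (kernel_group (critical_group E (line_edges E)) (critical_group V E) g)"
proof -
  let ?FE = "free_Abelian_group E" and ?FV = "free_Abelian_group V"
  let ?CE = "coker ?FE ?FE (laplacian (line_edges E))" and ?CV = "coker ?FV ?FV (laplacian E)"
  \<comment> \<open>The map is built on the full cokernels and restricts to torsion subgroups, as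
    any homomorphism does.\<close>
  obtain g where g: "g \<in> hom ?CE ?CV"
    and g_class': "\<And>x. x \<in> carrier ?FE \<Longrightarrow> g (line.divisor_class x) = divisor_class (down wt x)"
    by (rule coker_induced_hom[OF group_free_Abelian_group abelian_free_Abelian_group line.laplacian_hom
          group_free_Abelian_group abelian_free_Abelian_group laplacian_hom down_hom down_principal])
      blast
  have g_class: "g (line.divisor_class x) = divisor_class (down wt x)"
    if "Poly_Mapping.keys x \<subseteq> E" for x
    using that by (intro g_class') simp
  have comm: "comm_group ?CE" "comm_group ?CV"
    by (intro comm_group_coker group_free_Abelian_group abelian_free_Abelian_group laplacian_hom
        line.laplacian_hom)+
  have hom: "g \<in> hom (critical_group E (line_edges E)) (critical_group V E)"
    unfolding critical_group_def
    by (intro hom_torsion_subgroup comm_group.axioms(2) comm g)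
  have "y [^]\<^bsub>critical_group V E\<^esub> lcm d1 d2 \<in> g ` carrier (critical_group E (line_edges E))"
    if "y \<in> carrier (critical_group V E)" for y
  proof -
    obtain x where x: "Poly_Mapping.keys x \<subseteq> V" "y = divisor_class x"
        and tors: "\<exists>n::nat. n > 0 \<and> frag_cmul (int n) x \<in> principal"
      using \<open>y \<in> carrier (critical_group V E)\<close> unfolding carrier_critical_group by blast
    have deg: "deg x = 0"
      using tors torsion_iff_degree_zero[OF x(1)] by blast
    obtain z where z: "Poly_Mapping.keys z \<subseteq> E"
        "frag_cmul (int (lcm d1 d2)) x - down wt z \<in> principal"
      by (rule degree_zero_lcm[OF x(1) deg])
    have kx: "Poly_Mapping.keys (frag_cmul (int (lcm d1 d2)) x) \<subseteq> V"
      using x(1) by (intro order_trans[OF keys_cmul])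
    obtain c where "Poly_Mapping.keys c \<subseteq> V"
        "frag_cmul (int (lcm d1 d2)) x - down wt z = laplacian E c"
      using z(2) by auto
    \<comment> \<open>\<open>down wt z\<close> differs from a divisor of degree 0 by a principal
      one. Its degree is therefore 0, which makes the class of \<open>z\<close> torsion.\<close>
    then have dz: "deg (down wt z) = 0"
      using deg_laplacian[of c] deg by (metis deg_cmul deg_diff diff_0 mult_zero_right neg_equal_0_iff_equal)
    obtain n :: nat where "n > 0" "frag_cmul (int n) z \<in> line.principal"
      by (rule down_torsion[OF z(1) dz])
    then have "line.divisor_class z \<in> carrier (critical_group E (line_edges E))"
      using z(1) unfolding line.carrier_critical_group by (intro CollectI exI[of _ z] conjI exI[of _ n] refl)
    moreover have "y [^]\<^bsub>critical_group V E\<^esub> lcm d1 d2 = divisor_class (frag_cmul (int (lcm d1 d2)) x)"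
      using normal.FactGroup_pow[OF normal_principal, of x "lcm d1 d2"] x
      by (simp add: critical_group_def coker_def)
    moreover have "divisor_class (frag_cmul (int (lcm d1 d2)) x) = g (line.divisor_class z)"
      unfolding g_class[OF z(1)] by (rule divisor_class_eq[OF kx keys_down[OF z(1)] z(2)])
    ultimately show ?thesis
      by (intro image_eqI) simp_all
  qed
  then have "all_torsion (lcm d1 d2) (coker (critical_group E (line_edges E)) (critical_group V E) g)"
    using all_torsion_coker_iff[OF comm_group.axioms(2)[OF line.comm_group_critical_group]
        comm_group_critical_group hom] by blast
  moreover have "x [^]\<^bsub>critical_group E (line_edges E)\<^esub> ((d1 + d2) div gcd d1 d2 * lcm d1 d2)
      = \<one>\<^bsub>critical_group E (line_edges E)\<^esub>"
    if x: "x \<in> carrier (critical_group E (line_edges E))" "g x = \<one>\<^bsub>critical_group V E\<^esub>" for x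
  proof -
    obtain c where c: "Poly_Mapping.keys c \<subseteq> E" "x = line.divisor_class c"
      using x(1) unfolding line.carrier_critical_group by blast
    have "divisor_class (down wt c) = principal"
      using x(2) unfolding c(2) g_class[OF c(1)] by (simp add: critical_group_def coker_def)
    moreover have "down wt c \<in> carrier ?FV"
      using keys_down[OF c(1)] by simp
    ultimately have "down wt c \<in> principal"
      using coset_eq_self_iff[OF subgroup_principal group_free_Abelian_group] by blast
    then show ?thesis
      using down_principal_imp[OF c(1)] line.divisor_class_pow_eq_one_iff[OF c(1)]
      unfolding c(2) critical_group_def pow_torsion_subgroup one_torsion_subgroup by blast
  qed
  then have "all_torsion ((d1 + d2) div gcd d1 d2 * lcm d1 d2)
      (kernel_group (critical_group E (line_edges E)) (critical_group V E) g)"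
    unfolding all_torsion_kernel_group_iff by blast
  ultimately show thesis
    using that[OF hom] by blast
qed

end

theorem theorem1p5:
  fixes V V1 V2 :: "'a set" and E :: "'a set set" and d1 d2 :: nat
  assumes "simple_graph V E"
    and "connected_graph V E"
    and "semiregular_bipartite V E V1 V2 d1 d2"
  shows "\<exists>g \<in> hom (critical_group E (line_edges E)) (critical_group V E).
    exact_0ABCD0
      (kernel_group (critical_group E (line_edges E)) (critical_group V E) g) (\<lambda>x. x)
      (critical_group E (line_edges E)) g
      (critical_group V E)
      (\<lambda>y. (g ` carrier (critical_group E (line_edges E))) #>\<^bsub>critical_group V E\<^esub> y)
      (coker (critical_group E (line_edges E)) (critical_group V E) g) \<and>
    all_torsion (lcm d1 d2)
      (coker (critical_group E (line_edges E)) (critical_group V E) g) \<and>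
    all_torsion ((d1 + d2) div gcd d1 d2 * lcm d1 d2)
      (kernel_group (critical_group E (line_edges E)) (critical_group V E) g)"
proof -
  interpret semiregular_graph V E V1 V2 d1 d2
    by unfold_locales (use assms in auto)
  obtain g where "g \<in> hom (critical_group E (line_edges E)) (critical_group V E)"
    and "all_torsion (lcm d1 d2) (coker (critical_group E (line_edges E)) (critical_group V E) g)"
    and "all_torsion ((d1 + d2) div gcd d1 d2 * lcm d1 d2)
      (kernel_group (critical_group E (line_edges E)) (critical_group V E) g)"
    by (rule critical_group_hom)
  then show ?thesis
    using kernel_cokernel_exact[OF comm_group.axioms(2)[OF line.comm_group_critical_group]
        comm_group_critical_group] by blast
qed

end
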